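(* For a smooth solution (with states in $\Omega$) of the OFTT-Euler system in one space dimension, the following equality holds: $$\partial_t s+ v_x \,\partial_x s=0,$$ which results in the entropy equality $$\partial_t \mathcal E+ \partial_x \mathbf q_x=0,$$ where $s=\frac{1}{\gamma_e-1}\ln\left(\frac{p_e}{\rho^{\gamma_e}}\right)+\frac{1}{\gamma_i-1}\ln\left(\frac{p_i}{\rho^{\gamma_i}}\right)$, $\mathcal E=-\rho s$ and $\mathbf q_x=-\rho v_x s$.
   Context: The One-Fluid Two-Temperature Euler (OFTT-Euler) system, for density $\rho$, velocity $\boldsymbol v=(v_x,v_y)$, electron pressure $p_e$ and ion pressure $p_i$, with constants $\gamma_e>1,\gamma_i>1$, total pressure $p=p_e+p_i$ and total energy $E=\frac{p_e}{\gamma_e-1}+\frac{p_i}{\gamma_i-1}+\frac{\rho|\boldsymbol v|^2}2$, is $$\partial_t\rho+\nabla\cdot(\rho\boldsymbol v)=0,\quad \partial_t(\rho\boldsymbol v)+\nabla\cdot(\rho\boldsymbol v\otimes\boldsymbol v+p\mathbf I)=0,\quad \partial_tE+\nabla\cdot((E+p)\boldsymbol v)=0,\quad \partial_tp_i+\nabla\cdot(p_i\boldsymbol v)=-(\gamma_i-1)p_i\nabla\cdot\boldsymbol v.$$ Equivalently (for smooth solutions), the energy equation may be replaced by $\partial_t p_e+\nabla\cdot(p_e\boldsymbol v)=-(\gamma_e-1)p_e\nabla\cdot\boldsymbol v$. One space dimension means that all quantities depend only on $(x,t)$. The admissible set is $\Omega=\{\rho>0,\ p_e>0,\ p_i>0\}$.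 *)

theory Defs
  imports "HOL-Analysis.Analysis"
begin

definition continuously_differentiable_on ::
  "('a::real_normed_vector \<Rightarrow> 'b::real_normed_vector) \<Rightarrow> 'a set \<Rightarrow> bool"
  where "continuously_differentiable_on f D \<longleftrightarrow>
    (\<exists>f' :: 'a \<Rightarrow> 'a \<Rightarrow>\<^sub>L 'b.
       (\<forall>z\<in>D. (f has_derivative blinfun_apply (f' z)) (at z)) \<and> continuous_on D f')"

type_synonym field2 = "real \<Rightarrow> real \<Rightarrow> real \<Rightarrow> real" \<comment> \<open>arguments in the order \<open>x\<close>, \<open>y\<close>, \<open>t\<close>\<close>

definition partial_x :: "field2 \<Rightarrow> field2"
  where "partial_x f x y t = deriv (\<lambda>\<xi>. f \<xi> y t) x"

definition partial_y :: "field2 \<Rightarrow> field2"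
  where "partial_y f x y t = deriv (\<lambda>\<eta>. f x \<eta> t) y"

definition partial_t :: "field2 \<Rightarrow> field2"
  where "partial_t f x y t = deriv (\<lambda>\<tau>. f x y \<tau>) t"

definition divergence :: "field2 \<Rightarrow> field2 \<Rightarrow> field2"
  where "divergence F\<^sub>x F\<^sub>y x y t = partial_x F\<^sub>x x y t + partial_y F\<^sub>y x y t"

definition total_energy :: "real \<Rightarrow> real \<Rightarrow> real \<Rightarrow> real \<Rightarrow> real \<Rightarrow> real \<Rightarrow> real \<Rightarrow> real"
  where "total_energy \<gamma>\<^sub>e \<gamma>\<^sub>i \<rho> v\<^sub>x v\<^sub>y p\<^sub>e p\<^sub>i =
    p\<^sub>e / (\<gamma>\<^sub>e - 1) + p\<^sub>i / (\<gamma>\<^sub>i - 1) + \<rho> * (v\<^sub>x\<^sup>2 + v\<^sub>y\<^sup>2) / 2"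

text \<open>
  The equations hold pointwise on a set \<open>D\<close> of points \<open>(x, y, t)\<close>; the momentum equation is
  written as its two components. Since \<^const>\<open>deriv\<close> is total, the predicate has its
  intended meaning only together with differentiability of the five fields.
\<close>

definition OFTT_Euler_system ::
  "real \<Rightarrow> real \<Rightarrow> (real \<times> real \<times> real) set \<Rightarrow>
   field2 \<Rightarrow> field2 \<Rightarrow> field2 \<Rightarrow> field2 \<Rightarrow> field2 \<Rightarrow> bool"
  where "OFTT_Euler_system \<gamma>\<^sub>e \<gamma>\<^sub>i D \<rho> v\<^sub>x v\<^sub>y p\<^sub>e p\<^sub>i \<longleftrightarrow>
    (let p = (\<lambda>x y t. p\<^sub>e x y t + p\<^sub>i x y t);
         E = (\<lambda>x y t. total_energy \<gamma>\<^sub>e \<gamma>\<^sub>i (\<rho> x y t) (v\<^sub>x x y t) (v\<^sub>y x y t) (p\<^sub>e x y t) (p\<^sub>i x y t))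
     in \<forall>(x, y, t)\<in>D.
       partial_t \<rho> x y t
         + divergence (\<lambda>x y t. \<rho> x y t * v\<^sub>x x y t) (\<lambda>x y t. \<rho> x y t * v\<^sub>y x y t) x y t = 0 \<and>
       partial_t (\<lambda>x y t. \<rho> x y t * v\<^sub>x x y t) x y t
         + divergence (\<lambda>x y t. \<rho> x y t * v\<^sub>x x y t * v\<^sub>x x y t + p x y t)
                      (\<lambda>x y t. \<rho> x y t * v\<^sub>x x y t * v\<^sub>y x y t) x y t = 0 \<and>
       partial_t (\<lambda>x y t. \<rho> x y t * v\<^sub>y x y t) x y t
         + divergence (\<lambda>x y t. \<rho> x y t * v\<^sub>y x y t * v\<^sub>x x y t)
                      (\<lambda>x y t. \<rho> x y t * v\<^sub>y x y t * v\<^sub>y x y t + p x y t) x y t = 0 \<and>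
       partial_t E x y t
         + divergence (\<lambda>x y t. (E x y t + p x y t) * v\<^sub>x x y t)
                      (\<lambda>x y t. (E x y t + p x y t) * v\<^sub>y x y t) x y t = 0 \<and>
       partial_t p\<^sub>i x y t
         + divergence (\<lambda>x y t. p\<^sub>i x y t * v\<^sub>x x y t) (\<lambda>x y t. p\<^sub>i x y t * v\<^sub>y x y t) x y t
         = - (\<gamma>\<^sub>i - 1) * p\<^sub>i x y t * divergence v\<^sub>x v\<^sub>y x y t)"

text \<open>
  A smooth one-dimensional solution on a set \<open>D\<close> of points \<open>(x, t)\<close>: the fields, including
  the transverse velocity \<open>v\<^sub>y\<close>, do not depend on \<open>y\<close>, are \<open>C\<^sup>1\<close> in \<open>(x, t)\<close>, take
  admissible values, and solve the system on the cylinder over \<open>D\<close> in the \<open>y\<close> direction.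
\<close>

definition smooth_OFTT_Euler_solution_1D ::
  "real \<Rightarrow> real \<Rightarrow> (real \<times> real) set \<Rightarrow>
   (real \<Rightarrow> real \<Rightarrow> real) \<Rightarrow> (real \<Rightarrow> real \<Rightarrow> real) \<Rightarrow> (real \<Rightarrow> real \<Rightarrow> real) \<Rightarrow>
   (real \<Rightarrow> real \<Rightarrow> real) \<Rightarrow> (real \<Rightarrow> real \<Rightarrow> real) \<Rightarrow> bool"
  where "smooth_OFTT_Euler_solution_1D \<gamma>\<^sub>e \<gamma>\<^sub>i D \<rho> v\<^sub>x v\<^sub>y p\<^sub>e p\<^sub>i \<longleftrightarrow>
    (\<forall>f\<in>{\<rho>, v\<^sub>x, v\<^sub>y, p\<^sub>e, p\<^sub>i}. continuously_differentiable_on (\<lambda>(x, t). f x t) D) \<and>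
    (\<forall>(x, t)\<in>D. \<rho> x t > 0 \<and> p\<^sub>e x t > 0 \<and> p\<^sub>i x t > 0) \<and>
    OFTT_Euler_system \<gamma>\<^sub>e \<gamma>\<^sub>i {(x, y, t). (x, t) \<in> D}
      (\<lambda>x y t. \<rho> x t) (\<lambda>x y t. v\<^sub>x x t) (\<lambda>x y t. v\<^sub>y x t) (\<lambda>x y t. p\<^sub>e x t) (\<lambda>x y t. p\<^sub>i x t)"

definition specific_entropy :: "real \<Rightarrow> real \<Rightarrow> real \<Rightarrow> real \<Rightarrow> real \<Rightarrow> real"
  where "specific_entropy \<gamma>\<^sub>e \<gamma>\<^sub>i \<rho> p\<^sub>e p\<^sub>i =
    1 / (\<gamma>\<^sub>e - 1) * ln (p\<^sub>e / \<rho> powr \<gamma>\<^sub>e) + 1 / (\<gamma>\<^sub>i - 1) * ln (p\<^sub>i / \<rho> powr \<gamma>\<^sub>i)"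

definition entropy_function :: "real \<Rightarrow> real \<Rightarrow> real \<Rightarrow> real \<Rightarrow> real \<Rightarrow> real"
  where "entropy_function \<gamma>\<^sub>e \<gamma>\<^sub>i \<rho> p\<^sub>e p\<^sub>i = - \<rho> * specific_entropy \<gamma>\<^sub>e \<gamma>\<^sub>i \<rho> p\<^sub>e p\<^sub>i"

definition entropy_flux_x :: "real \<Rightarrow> real \<Rightarrow> real \<Rightarrow> real \<Rightarrow> real \<Rightarrow> real \<Rightarrow> real"
  where "entropy_flux_x \<gamma>\<^sub>e \<gamma>\<^sub>i \<rho> v\<^sub>x p\<^sub>e p\<^sub>i = - \<rho> * v\<^sub>x * specific_entropy \<gamma>\<^sub>e \<gamma>\<^sub>i \<rho> p\<^sub>e p\<^sub>i"

end

theory Submission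
  imports Defs
begin

text \<open>
  Along the flow, with material derivative \<open>d/dt = \<partial>\<^sub>t + v\<^sub>x \<partial>\<^sub>x\<close>, the density and both pressures are
  driven only by the compression rate \<open>\<partial>\<^sub>x v\<^sub>x\<close>: \<open>d ln \<rho>/dt = - \<partial>\<^sub>x v\<^sub>x\<close> and
  \<open>d ln p\<^sub>\<alpha>/dt = - \<gamma>\<^sub>\<alpha> \<partial>\<^sub>x v\<^sub>x\<close> for each species \<open>\<alpha> \<in> {e, i}\<close>. Hence each \<open>ln p\<^sub>\<alpha> - \<gamma>\<^sub>\<alpha> ln \<rho>\<close> is
  transported, and so is \<open>s\<close>. Multiplying the transport equation of \<open>s\<close> by \<open>\<rho>\<close> and adding \<open>s\<close>
  times the mass equation puts it in conservation form.

  Mass and ion pressure give their laws directly from the system. The electron pressure does not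
  occur there by itself: its law is what remains of the energy equation after the kinetic energy
  is removed by means of mass and momentum, and the ion part by means of the ion equation
  (\<open>electron_pressure_balance\<close>). The laws for \<open>\<rho>\<close>, \<open>p\<^sub>e\<close>, \<open>p\<^sub>i\<close> at a point of the domain are
  \<open>OFTT_Euler_1D_transport_laws\<close>; the differential of \<open>s\<close> is
  \<open>has_real_derivative_specific_entropy\<close>.
\<close>

text \<open>
  The operator \<^const>\<open>deriv\<close> says nothing at a point where the function is not differentiable;
  the total derivative supplies the differentiability of the two slices.
\<close>

lemma continuously_differentiable_on_slices:
  fixes f :: "real \<Rightarrow> real \<Rightarrow> real"
  assumes "continuously_differentiable_on (\<lambda>(x, t). f x t) D" and "(x, t) \<in> D"
  shows "((\<lambda>\<tau>. f x \<tau>) has_real_derivative deriv (\<lambda>\<tau>. f x \<tau>) t) (at t)"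
    and "((\<lambda>\<xi>. f \<xi> t) has_real_derivative deriv (\<lambda>\<xi>. f \<xi> t) x) (at x)"
proof -
  obtain L where L: "((\<lambda>(x, t). f x t) has_derivative L) (at (x, t))"
    using assms unfolding continuously_differentiable_on_def by blast
  have "((\<lambda>\<tau>. (x, \<tau>)) has_derivative (\<lambda>h. (0, h))) (at t)"
    by (auto intro!: derivative_eq_intros)
  from diff_chain_at[OF this L] have "(\<lambda>\<tau>. f x \<tau>) differentiable (at t)"
    by (auto simp: o_def differentiable_def)
  then show "((\<lambda>\<tau>. f x \<tau>) has_real_derivative deriv (\<lambda>\<tau>. f x \<tau>) t) (at t)"
    by (simp add: DERIV_deriv_iff_real_differentiable)
  have "((\<lambda>\<xi>. (\<xi>, t)) has_derivative (\<lambda>h. (h, 0))) (at x)"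
    by (auto intro!: derivative_eq_intros)
  from diff_chain_at[OF this L] have "(\<lambda>\<xi>. f \<xi> t) differentiable (at x)"
    by (auto simp: o_def differentiable_def)
  then show "((\<lambda>\<xi>. f \<xi> t) has_real_derivative deriv (\<lambda>\<xi>. f \<xi> t) x) (at x)"
    by (simp add: DERIV_deriv_iff_real_differentiable)
qed

lemma has_real_derivative_total_energy:
  assumes "(\<rho> has_real_derivative \<rho>') (at z)"
    and "(u has_real_derivative u') (at z)" and "(v has_real_derivative v') (at z)"
    and "(p\<^sub>e has_real_derivative p\<^sub>e') (at z)" and "(p\<^sub>i has_real_derivative p\<^sub>i') (at z)"
  shows "((\<lambda>z. total_energy \<gamma>\<^sub>e \<gamma>\<^sub>i (\<rho> z) (u z) (v z) (p\<^sub>e z) (p\<^sub>i z)) has_real_derivative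
    p\<^sub>e' / (\<gamma>\<^sub>e - 1) + p\<^sub>i' / (\<gamma>\<^sub>i - 1)
      + \<rho>' * ((u z)\<^sup>2 + (v z)\<^sup>2) / 2 + \<rho> z * (u z * u' + v z * v')) (at z)"
  unfolding total_energy_def
  by (rule DERIV_cong[OF DERIV_add[OF DERIV_add[OF
        DERIV_cdivide[OF assms(4)] DERIV_cdivide[OF assms(5)]]
        DERIV_cdivide[OF DERIV_mult[OF assms(1)
          DERIV_add[OF DERIV_power[OF assms(2)] DERIV_power[OF assms(3)]]]]]])
    (simp add: algebra_simps add_divide_distrib)

text \<open>
  Writing \<open>ln (p / \<rho> powr \<gamma>)\<close> as \<open>ln p - \<gamma> ln \<rho>\<close> would require positivity near \<open>z\<close>; differentiating
  the quotient needs it at \<open>z\<close> only.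
\<close>

lemma has_real_derivative_specific_entropy:
  assumes "(\<rho> has_real_derivative \<rho>') (at z)"
    and "(p\<^sub>e has_real_derivative p\<^sub>e') (at z)" and "(p\<^sub>i has_real_derivative p\<^sub>i') (at z)"
    and "\<rho> z > 0" "p\<^sub>e z > 0" "p\<^sub>i z > 0"
  shows "((\<lambda>z. specific_entropy \<gamma>\<^sub>e \<gamma>\<^sub>i (\<rho> z) (p\<^sub>e z) (p\<^sub>i z)) has_real_derivative
    (p\<^sub>e' / p\<^sub>e z - \<gamma>\<^sub>e * \<rho>' / \<rho> z) / (\<gamma>\<^sub>e - 1) + (p\<^sub>i' / p\<^sub>i z - \<gamma>\<^sub>i * \<rho>' / \<rho> z) / (\<gamma>\<^sub>i - 1)) (at z)"
proof -
  have log: "((\<lambda>z. ln (p z / \<rho> z powr \<gamma>)) has_real_derivative p' / p z - \<gamma> * \<rho>' / \<rho> z) (at z)"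
    if "(p has_real_derivative p') (at z)" "p z > 0" for p :: "real \<Rightarrow> real" and p' \<gamma>
  proof -
    have "((\<lambda>z. \<rho> z powr \<gamma>) has_real_derivative \<gamma> * \<rho> z powr \<gamma> / \<rho> z * \<rho>') (at z)"
      using DERIV_fun_powr[OF assms(1) assms(4), of \<gamma>] assms(4) by (simp add: powr_diff)
    from DERIV_chain2[OF DERIV_ln_divide DERIV_divide[OF that(1) this]]
    show ?thesis
      by (rule DERIV_cong) (use that(2) assms(4) in \<open>auto simp: field_simps\<close>)
  qed
  show ?thesis
    unfolding specific_entropy_def
    by (rule DERIV_cong[OF
        DERIV_add[OF DERIV_cmult[OF log[OF assms(2,5)]] DERIV_cmult[OF log[OF assms(3,6)]]]]) simp
qed

text \<open>
  Total energy minus kinetic energy, as an identity between the values of the fields and of their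
  derivatives at one point, with velocity \<open>(u, v)\<close>; subscripts \<open>t\<close> and \<open>x\<close> denote partial
  derivatives. The energy equation minus \<open>u\<close> and \<open>v\<close> times the two momentum equations plus
  \<open>(u\<^sup>2 + v\<^sup>2)/2\<close> times the mass equation is the balance of the sum of the two internal energies, from
  which the ion balance is then subtracted.
\<close>

lemma electron_pressure_balance:
  fixes \<rho> u v p\<^sub>e p\<^sub>i \<rho>t \<rho>x ut ux vt vx p\<^sub>et p\<^sub>ex p\<^sub>it p\<^sub>ix \<gamma>\<^sub>e \<gamma>\<^sub>i :: real
  assumes \<gamma>: "\<gamma>\<^sub>e \<noteq> 1" "\<gamma>\<^sub>i \<noteq> 1"
    and mass: "\<rho>t + (\<rho>x * u + \<rho> * ux) = 0"
    and momentum_x: "(\<rho>t * u + \<rho> * ut) + ((\<rho>x * u + \<rho> * ux) * u + \<rho> * u * ux + (p\<^sub>ex + p\<^sub>ix)) = 0"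
    and momentum_y: "(\<rho>t * v + \<rho> * vt) + ((\<rho>x * v + \<rho> * vx) * u + \<rho> * v * ux) = 0"
    and energy: "p\<^sub>et / (\<gamma>\<^sub>e - 1) + p\<^sub>it / (\<gamma>\<^sub>i - 1) + \<rho>t * (u\<^sup>2 + v\<^sup>2) / 2 + \<rho> * (u * ut + v * vt)
      + ((p\<^sub>ex / (\<gamma>\<^sub>e - 1) + p\<^sub>ix / (\<gamma>\<^sub>i - 1) + \<rho>x * (u\<^sup>2 + v\<^sup>2) / 2 + \<rho> * (u * ux + v * vx)
          + (p\<^sub>ex + p\<^sub>ix)) * u
        + (total_energy \<gamma>\<^sub>e \<gamma>\<^sub>i \<rho> u v p\<^sub>e p\<^sub>i + (p\<^sub>e + p\<^sub>i)) * ux) = 0"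
    and ion: "p\<^sub>it + u * p\<^sub>ix = - \<gamma>\<^sub>i * p\<^sub>i * ux"
  shows "p\<^sub>et + u * p\<^sub>ex = - \<gamma>\<^sub>e * p\<^sub>e * ux"
proof -
  define a where "a = 1 / (\<gamma>\<^sub>e - 1)"
  define b where "b = 1 / (\<gamma>\<^sub>i - 1)"
  have a: "a * (\<gamma>\<^sub>e - 1) = 1" and b: "b * (\<gamma>\<^sub>i - 1) = 1"
    using \<gamma> by (simp_all add: a_def b_def)
  have div: "q / (\<gamma>\<^sub>e - 1) = a * q" "q / (\<gamma>\<^sub>i - 1) = b * q" for q
    by (simp_all add: a_def b_def)
  let ?mass = "\<rho>t + (\<rho>x * u + \<rho> * ux)"
  let ?mom_x = "(\<rho>t * u + \<rho> * ut) + ((\<rho>x * u + \<rho> * ux) * u + \<rho> * u * ux + (p\<^sub>ex + p\<^sub>ix))"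
  let ?mom_y = "(\<rho>t * v + \<rho> * vt) + ((\<rho>x * v + \<rho> * vx) * u + \<rho> * v * ux)"
  let ?energy = "a * p\<^sub>et + b * p\<^sub>it + \<rho>t * (u\<^sup>2 + v\<^sup>2) / 2 + \<rho> * (u * ut + v * vt)
      + ((a * p\<^sub>ex + b * p\<^sub>ix + \<rho>x * (u\<^sup>2 + v\<^sup>2) / 2 + \<rho> * (u * ux + v * vx) + (p\<^sub>ex + p\<^sub>ix)) * u
        + (a * p\<^sub>e + b * p\<^sub>i + \<rho> * (u\<^sup>2 + v\<^sup>2) / 2 + (p\<^sub>e + p\<^sub>i)) * ux)"
  have "?energy - u * ?mom_x - v * ?mom_y + (u\<^sup>2 + v\<^sup>2) / 2 * ?mass
      = a * (p\<^sub>et + u * p\<^sub>ex + p\<^sub>e * ux) + b * (p\<^sub>it + u * p\<^sub>ix + p\<^sub>i * ux) + (p\<^sub>e + p\<^sub>i) * ux"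
    by (simp add: field_simps power2_eq_square)
  moreover have "?energy = 0"
    using energy by (simp only: total_energy_def div)
  ultimately have internal:
    "a * (p\<^sub>et + u * p\<^sub>ex + p\<^sub>e * ux) + b * (p\<^sub>it + u * p\<^sub>ix + p\<^sub>i * ux) + (p\<^sub>e + p\<^sub>i) * ux = 0"
    by (simp only: mass momentum_x momentum_y)
  have "b * (p\<^sub>it + u * p\<^sub>ix + p\<^sub>i * ux) = - (b * (\<gamma>\<^sub>i - 1)) * (p\<^sub>i * ux)"
    unfolding ion by (simp add: algebra_simps)
  then have "b * (p\<^sub>it + u * p\<^sub>ix + p\<^sub>i * ux) = - (p\<^sub>i * ux)"
    unfolding b by simp
  with internal have "a * (p\<^sub>et + u * p\<^sub>ex + p\<^sub>e * ux) = - (p\<^sub>e * ux)"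
    unfolding distrib_right[of p\<^sub>e] by linarith
  moreover have "(a * (\<gamma>\<^sub>e - 1)) * q = (\<gamma>\<^sub>e - 1) * (a * q)" for q
    by simp
  ultimately have
    "(a * (\<gamma>\<^sub>e - 1)) * (p\<^sub>et + u * p\<^sub>ex + p\<^sub>e * ux) = (\<gamma>\<^sub>e - 1) * - (p\<^sub>e * ux)"
    by metis
  then show ?thesis
    unfolding a by (simp add: algebra_simps)
qed

text \<open>
  The nonconservative form of the system at one point. All \<open>y\<close>-fluxes are constant in \<open>y\<close>, so
  their derivatives vanish, and the remaining ones expand by the product rule.
\<close>

lemma OFTT_Euler_1D_transport_laws:
  assumes \<gamma>: "\<gamma>\<^sub>e > 1" "\<gamma>\<^sub>i > 1"
    and sol: "smooth_OFTT_Euler_solution_1D \<gamma>\<^sub>e \<gamma>\<^sub>i D \<rho> v\<^sub>x v\<^sub>y p\<^sub>e p\<^sub>i"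
    and pt: "(x, t) \<in> D"
  defines "c \<equiv> deriv (\<lambda>\<xi>. v\<^sub>x \<xi> t) x"
  shows "deriv (\<lambda>\<tau>. \<rho> x \<tau>) t + v\<^sub>x x t * deriv (\<lambda>\<xi>. \<rho> \<xi> t) x = - \<rho> x t * c"
    and "deriv (\<lambda>\<tau>. p\<^sub>e x \<tau>) t + v\<^sub>x x t * deriv (\<lambda>\<xi>. p\<^sub>e \<xi> t) x = - \<gamma>\<^sub>e * p\<^sub>e x t * c"
    and "deriv (\<lambda>\<tau>. p\<^sub>i x \<tau>) t + v\<^sub>x x t * deriv (\<lambda>\<xi>. p\<^sub>i \<xi> t) x = - \<gamma>\<^sub>i * p\<^sub>i x t * c"
proof -
  have C1: "continuously_differentiable_on (\<lambda>(x, t). f x t) D" if "f \<in> {\<rho>, v\<^sub>x, v\<^sub>y, p\<^sub>e, p\<^sub>i}" for f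
    using sol that unfolding smooth_OFTT_Euler_solution_1D_def by blast
  note d\<rho> = continuously_differentiable_on_slices[OF C1[of \<rho>] pt, simplified]
  note du = continuously_differentiable_on_slices[OF C1[of v\<^sub>x] pt, simplified]
  note dv = continuously_differentiable_on_slices[OF C1[of v\<^sub>y] pt, simplified]
  note de = continuously_differentiable_on_slices[OF C1[of p\<^sub>e] pt, simplified]
  note di = continuously_differentiable_on_slices[OF C1[of p\<^sub>i] pt, simplified]
  note dE = has_real_derivative_total_energy[OF d\<rho>(1) du(1) dv(1) de(1) di(1)]
    has_real_derivative_total_energy[OF d\<rho>(2) du(2) dv(2) de(2) di(2)]
  note rules = d\<rho> du dv de di dE

  let ?\<rho>t = "deriv (\<lambda>\<tau>. \<rho> x \<tau>) t" and ?\<rho>x = "deriv (\<lambda>\<xi>. \<rho> \<xi> t) x"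
  let ?u = "v\<^sub>x x t" and ?ut = "deriv (\<lambda>\<tau>. v\<^sub>x x \<tau>) t" and ?ux = "deriv (\<lambda>\<xi>. v\<^sub>x \<xi> t) x"
  let ?v = "v\<^sub>y x t" and ?vt = "deriv (\<lambda>\<tau>. v\<^sub>y x \<tau>) t" and ?vx = "deriv (\<lambda>\<xi>. v\<^sub>y \<xi> t) x"
  let ?et = "deriv (\<lambda>\<tau>. p\<^sub>e x \<tau>) t" and ?ex = "deriv (\<lambda>\<xi>. p\<^sub>e \<xi> t) x"
  let ?it = "deriv (\<lambda>\<tau>. p\<^sub>i x \<tau>) t" and ?ix = "deriv (\<lambda>\<xi>. p\<^sub>i \<xi> t) x"
  let ?E = "\<lambda>x t. total_energy \<gamma>\<^sub>e \<gamma>\<^sub>i (\<rho> x t) (v\<^sub>x x t) (v\<^sub>y x t) (p\<^sub>e x t) (p\<^sub>i x t)"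

  have system:
    "?\<rho>t + deriv (\<lambda>\<xi>. \<rho> \<xi> t * v\<^sub>x \<xi> t) x = 0"
    "deriv (\<lambda>\<tau>. \<rho> x \<tau> * v\<^sub>x x \<tau>) t
      + deriv (\<lambda>\<xi>. \<rho> \<xi> t * v\<^sub>x \<xi> t * v\<^sub>x \<xi> t + (p\<^sub>e \<xi> t + p\<^sub>i \<xi> t)) x = 0"
    "deriv (\<lambda>\<tau>. \<rho> x \<tau> * v\<^sub>y x \<tau>) t + deriv (\<lambda>\<xi>. \<rho> \<xi> t * v\<^sub>y \<xi> t * v\<^sub>x \<xi> t) x = 0"
    "deriv (\<lambda>\<tau>. ?E x \<tau>) t + deriv (\<lambda>\<xi>. (?E \<xi> t + (p\<^sub>e \<xi> t + p\<^sub>i \<xi> t)) * v\<^sub>x \<xi> t) x = 0"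
    "?it + deriv (\<lambda>\<xi>. p\<^sub>i \<xi> t * v\<^sub>x \<xi> t) x = - (\<gamma>\<^sub>i - 1) * p\<^sub>i x t * ?ux"
    using sol pt
    unfolding smooth_OFTT_Euler_solution_1D_def OFTT_Euler_system_def Let_def
      divergence_def partial_x_def partial_y_def partial_t_def
    by (fastforce simp: deriv_const)+

  have mass: "?\<rho>t + (?\<rho>x * ?u + \<rho> x t * ?ux) = 0"
  proof -
    have "deriv (\<lambda>\<xi>. \<rho> \<xi> t * v\<^sub>x \<xi> t) x = ?\<rho>x * ?u + \<rho> x t * ?ux"
      by (rule DERIV_imp_deriv) (auto intro!: derivative_eq_intros rules)
    with system(1) show ?thesis by simp
  qed
  then show "?\<rho>t + ?u * ?\<rho>x = - \<rho> x t * c"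
    by (simp add: c_def algebra_simps)

  have "deriv (\<lambda>\<xi>. p\<^sub>i \<xi> t * v\<^sub>x \<xi> t) x = ?ix * ?u + p\<^sub>i x t * ?ux"
    by (rule DERIV_imp_deriv) (auto intro!: derivative_eq_intros rules)
  with system(5) have ion: "?it + ?u * ?ix = - \<gamma>\<^sub>i * p\<^sub>i x t * ?ux"
    by (simp add: algebra_simps)
  then show "?it + ?u * ?ix = - \<gamma>\<^sub>i * p\<^sub>i x t * c"
    by (simp add: c_def)

  have momentum_x: "(?\<rho>t * ?u + \<rho> x t * ?ut)
      + ((?\<rho>x * ?u + \<rho> x t * ?ux) * ?u + \<rho> x t * ?u * ?ux + (?ex + ?ix)) = 0"
  proof -
    have "deriv (\<lambda>\<tau>. \<rho> x \<tau> * v\<^sub>x x \<tau>) t = ?\<rho>t * ?u + \<rho> x t * ?ut"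
      by (rule DERIV_imp_deriv) (auto intro!: derivative_eq_intros rules)
    moreover have "deriv (\<lambda>\<xi>. \<rho> \<xi> t * v\<^sub>x \<xi> t * v\<^sub>x \<xi> t + (p\<^sub>e \<xi> t + p\<^sub>i \<xi> t)) x
        = (?\<rho>x * ?u + \<rho> x t * ?ux) * ?u + \<rho> x t * ?u * ?ux + (?ex + ?ix)"
      by (rule DERIV_imp_deriv) (auto intro!: derivative_eq_intros rules simp: algebra_simps)
    ultimately show ?thesis using system(2) by simp
  qed
  have momentum_y: "(?\<rho>t * ?v + \<rho> x t * ?vt)
      + ((?\<rho>x * ?v + \<rho> x t * ?vx) * ?u + \<rho> x t * ?v * ?ux) = 0"
  proof -
    have "deriv (\<lambda>\<tau>. \<rho> x \<tau> * v\<^sub>y x \<tau>) t = ?\<rho>t * ?v + \<rho> x t * ?vt"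
      by (rule DERIV_imp_deriv) (auto intro!: derivative_eq_intros rules)
    moreover have "deriv (\<lambda>\<xi>. \<rho> \<xi> t * v\<^sub>y \<xi> t * v\<^sub>x \<xi> t) x
        = (?\<rho>x * ?v + \<rho> x t * ?vx) * ?u + \<rho> x t * ?v * ?ux"
      by (rule DERIV_imp_deriv) (auto intro!: derivative_eq_intros rules simp: algebra_simps)
    ultimately show ?thesis using system(3) by simp
  qed
  have energy_flux: "deriv (\<lambda>\<xi>. (?E \<xi> t + (p\<^sub>e \<xi> t + p\<^sub>i \<xi> t)) * v\<^sub>x \<xi> t) x
      = (?ex / (\<gamma>\<^sub>e - 1) + ?ix / (\<gamma>\<^sub>i - 1) + ?\<rho>x * (?u\<^sup>2 + ?v\<^sup>2) / 2
          + \<rho> x t * (?u * ?ux + ?v * ?vx) + (?ex + ?ix)) * ?u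
        + (?E x t + (p\<^sub>e x t + p\<^sub>i x t)) * ?ux"
    by (rule DERIV_imp_deriv,
      rule DERIV_cong[OF DERIV_mult[OF DERIV_add[OF dE(2) DERIV_add[OF de(2) di(2)]] du(2)]]) simp
  show "?et + ?u * ?ex = - \<gamma>\<^sub>e * p\<^sub>e x t * c"
    unfolding c_def
    using electron_pressure_balance[OF _ _ mass momentum_x momentum_y _ ion, of \<gamma>\<^sub>e] \<gamma>
      system(4)[unfolded DERIV_imp_deriv[OF dE(1)] energy_flux]
    by simp
qed

theorem lemma3p1:
  fixes \<gamma>\<^sub>e \<gamma>\<^sub>i :: real
    and \<rho> v\<^sub>x v\<^sub>y p\<^sub>e p\<^sub>i :: "real \<Rightarrow> real \<Rightarrow> real"
    and D :: "(real \<times> real) set"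
  assumes "\<gamma>\<^sub>e > 1" and "\<gamma>\<^sub>i > 1"
    and "open D"
    and "smooth_OFTT_Euler_solution_1D \<gamma>\<^sub>e \<gamma>\<^sub>i D \<rho> v\<^sub>x v\<^sub>y p\<^sub>e p\<^sub>i"
  shows "(\<forall>(x, t)\<in>D.
      deriv (\<lambda>\<tau>. specific_entropy \<gamma>\<^sub>e \<gamma>\<^sub>i (\<rho> x \<tau>) (p\<^sub>e x \<tau>) (p\<^sub>i x \<tau>)) t
      + v\<^sub>x x t * deriv (\<lambda>\<xi>. specific_entropy \<gamma>\<^sub>e \<gamma>\<^sub>i (\<rho> \<xi> t) (p\<^sub>e \<xi> t) (p\<^sub>i \<xi> t)) x = 0) \<and>
    (\<forall>(x, t)\<in>D.
      deriv (\<lambda>\<tau>. entropy_function \<gamma>\<^sub>e \<gamma>\<^sub>i (\<rho> x \<tau>) (p\<^sub>e x \<tau>) (p\<^sub>i x \<tau>)) t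
      + deriv (\<lambda>\<xi>. entropy_flux_x \<gamma>\<^sub>e \<gamma>\<^sub>i (\<rho> \<xi> t) (v\<^sub>x \<xi> t) (p\<^sub>e \<xi> t) (p\<^sub>i \<xi> t)) x = 0)"
proof -
  let ?s = "\<lambda>x t. specific_entropy \<gamma>\<^sub>e \<gamma>\<^sub>i (\<rho> x t) (p\<^sub>e x t) (p\<^sub>i x t)"
  have main: "deriv (\<lambda>\<tau>. ?s x \<tau>) t + v\<^sub>x x t * deriv (\<lambda>\<xi>. ?s \<xi> t) x = 0 \<and>
      deriv (\<lambda>\<tau>. entropy_function \<gamma>\<^sub>e \<gamma>\<^sub>i (\<rho> x \<tau>) (p\<^sub>e x \<tau>) (p\<^sub>i x \<tau>)) t
      + deriv (\<lambda>\<xi>. entropy_flux_x \<gamma>\<^sub>e \<gamma>\<^sub>i (\<rho> \<xi> t) (v\<^sub>x \<xi> t) (p\<^sub>e \<xi> t) (p\<^sub>i \<xi> t)) x = 0"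
    if pt: "(x, t) \<in> D" for x t
  proof -
    have C1: "continuously_differentiable_on (\<lambda>(x, t). f x t) D" if "f \<in> {\<rho>, v\<^sub>x, p\<^sub>e, p\<^sub>i}" for f
      using assms(4) that unfolding smooth_OFTT_Euler_solution_1D_def by blast
    have pos: "\<rho> x t > 0" "p\<^sub>e x t > 0" "p\<^sub>i x t > 0"
      using assms(4) pt unfolding smooth_OFTT_Euler_solution_1D_def by blast+
    note d\<rho> = continuously_differentiable_on_slices[OF C1[of \<rho>] pt, simplified]
    note du = continuously_differentiable_on_slices[OF C1[of v\<^sub>x] pt, simplified]
    note de = continuously_differentiable_on_slices[OF C1[of p\<^sub>e] pt, simplified]
    note di = continuously_differentiable_on_slices[OF C1[of p\<^sub>i] pt, simplified]
    note laws = OFTT_Euler_1D_transport_laws[OF assms(1,2,4) pt]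
    let ?\<rho>t = "deriv (\<lambda>\<tau>. \<rho> x \<tau>) t" and ?\<rho>x = "deriv (\<lambda>\<xi>. \<rho> \<xi> t) x"
    let ?u = "v\<^sub>x x t" and ?ux = "deriv (\<lambda>\<xi>. v\<^sub>x \<xi> t) x"
    let ?et = "deriv (\<lambda>\<tau>. p\<^sub>e x \<tau>) t" and ?ex = "deriv (\<lambda>\<xi>. p\<^sub>e \<xi> t) x"
    let ?it = "deriv (\<lambda>\<tau>. p\<^sub>i x \<tau>) t" and ?ix = "deriv (\<lambda>\<xi>. p\<^sub>i \<xi> t) x"
    note st = has_real_derivative_specific_entropy[OF d\<rho>(1) de(1) di(1) pos, of \<gamma>\<^sub>e \<gamma>\<^sub>i]
    note sx = has_real_derivative_specific_entropy[OF d\<rho>(2) de(2) di(2) pos, of \<gamma>\<^sub>e \<gamma>\<^sub>i]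

    \<comment> \<open>The pressure contributes \<open>- \<gamma> \<partial>\<^sub>x v\<^sub>x\<close> and the density \<open>+ \<gamma> \<partial>\<^sub>x v\<^sub>x\<close>.\<close>
    have species: "(pt / p - \<gamma> * ?\<rho>t / \<rho> x t) + ?u * (px / p - \<gamma> * ?\<rho>x / \<rho> x t) = 0"
      if "pt + ?u * px = - \<gamma> * p * ?ux" "p > 0" for p pt px \<gamma>
    proof -
      have "(pt / p - \<gamma> * ?\<rho>t / \<rho> x t) + ?u * (px / p - \<gamma> * ?\<rho>x / \<rho> x t)
          = (pt + ?u * px) / p - \<gamma> * ((?\<rho>t + ?u * ?\<rho>x) / \<rho> x t)"
        using pos(1) that(2) by (simp add: field_simps)
      also have "\<dots> = 0"
        unfolding that(1) laws(1) using pos(1) that(2) by simp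
      finally show ?thesis .
    qed
    have "deriv (\<lambda>\<tau>. ?s x \<tau>) t + ?u * deriv (\<lambda>\<xi>. ?s \<xi> t) x
        = ((?et / p\<^sub>e x t - \<gamma>\<^sub>e * ?\<rho>t / \<rho> x t) + ?u * (?ex / p\<^sub>e x t - \<gamma>\<^sub>e * ?\<rho>x / \<rho> x t)) / (\<gamma>\<^sub>e - 1)
        + ((?it / p\<^sub>i x t - \<gamma>\<^sub>i * ?\<rho>t / \<rho> x t) + ?u * (?ix / p\<^sub>i x t - \<gamma>\<^sub>i * ?\<rho>x / \<rho> x t)) / (\<gamma>\<^sub>i - 1)"
      unfolding DERIV_imp_deriv[OF st] DERIV_imp_deriv[OF sx]
      by (simp only: add_divide_distrib distrib_left times_divide_eq_right ac_simps)
    then have transport: "deriv (\<lambda>\<tau>. ?s x \<tau>) t + ?u * deriv (\<lambda>\<xi>. ?s \<xi> t) x = 0"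
      by (simp only: species[OF laws(2) pos(2)] species[OF laws(3) pos(3)])

    have "((\<lambda>\<tau>. - \<rho> x \<tau> * ?s x \<tau>) has_real_derivative
        - ?\<rho>t * ?s x t - \<rho> x t * deriv (\<lambda>\<tau>. ?s x \<tau>) t) (at t)"
      by (rule DERIV_cong[OF
          DERIV_mult[OF DERIV_minus[OF d\<rho>(1)] st[folded DERIV_imp_deriv[OF st]]]])
        (simp add: algebra_simps)
    then have Et: "deriv (\<lambda>\<tau>. entropy_function \<gamma>\<^sub>e \<gamma>\<^sub>i (\<rho> x \<tau>) (p\<^sub>e x \<tau>) (p\<^sub>i x \<tau>)) t
        = - ?\<rho>t * ?s x t - \<rho> x t * deriv (\<lambda>\<tau>. ?s x \<tau>) t"
      unfolding entropy_function_def by (rule DERIV_imp_deriv)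
    have "((\<lambda>\<xi>. - \<rho> \<xi> t * v\<^sub>x \<xi> t * ?s \<xi> t) has_real_derivative
        - (?\<rho>x * ?u + \<rho> x t * ?ux) * ?s x t - \<rho> x t * ?u * deriv (\<lambda>\<xi>. ?s \<xi> t) x) (at x)"
      by (rule DERIV_cong[OF
          DERIV_mult[OF DERIV_mult[OF DERIV_minus[OF d\<rho>(2)] du(2)]
            sx[folded DERIV_imp_deriv[OF sx]]]])
        (simp add: algebra_simps)
    then have qx: "deriv (\<lambda>\<xi>. entropy_flux_x \<gamma>\<^sub>e \<gamma>\<^sub>i (\<rho> \<xi> t) (v\<^sub>x \<xi> t) (p\<^sub>e \<xi> t) (p\<^sub>i \<xi> t)) x
        = - (?\<rho>x * ?u + \<rho> x t * ?ux) * ?s x t - \<rho> x t * ?u * deriv (\<lambda>\<xi>. ?s \<xi> t) x"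
      unfolding entropy_flux_x_def by (rule DERIV_imp_deriv)
    have "deriv (\<lambda>\<tau>. entropy_function \<gamma>\<^sub>e \<gamma>\<^sub>i (\<rho> x \<tau>) (p\<^sub>e x \<tau>) (p\<^sub>i x \<tau>)) t
        + deriv (\<lambda>\<xi>. entropy_flux_x \<gamma>\<^sub>e \<gamma>\<^sub>i (\<rho> \<xi> t) (v\<^sub>x \<xi> t) (p\<^sub>e \<xi> t) (p\<^sub>i \<xi> t)) x
        = - (?\<rho>t + ?u * ?\<rho>x + \<rho> x t * ?ux) * ?s x t
          - \<rho> x t * (deriv (\<lambda>\<tau>. ?s x \<tau>) t + ?u * deriv (\<lambda>\<xi>. ?s \<xi> t) x)"
      unfolding Et qx by (simp add: algebra_simps)
    also have "\<dots> = 0"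
      unfolding transport laws(1) by simp
    finally show ?thesis
      using transport by blast
  qed
  then show ?thesis by blast
qed

end
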